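(* Let $k\ge 1$, $I=\{1,\ldots,k\}$, and let $F=\{f_i\}_{i\in I}\subseteq\mathbb{R}^2\setminus\{0\}$ be a finite frame for $\mathbb{R}^2$. Then there exists a frame $G=\{g_i\}_{i\in I}\subseteq \mathbb{R}^2\setminus\{0\}$ for $\mathbb{R}^2$ such that each $g_i$ is a scalar multiple of $e_1$ or of $e_2$, where $\{e_1,e_2\}$ is the standard orthonormal basis of $\mathbb{R}^2$, and such that the factor posets agree: $\mathbb{F}_F=\mathbb{F}_G$.
   Context: A finite sequence $\{f_i\}_{i\in I}$ of vectors (repetitions allowed) in a finite-dimensional Hilbert space $\mathcal{H}$ is a frame for $\mathcal{H}$ if there are constants $A,B>0$ with $A\|f\|^2\le\sum_{i\in I}|\langle f,f_i\rangle|^2\le B\|f\|^2$ for all $f\in\mathcal{H}$. It is a tight frame if one can take $A=B$. The factor poset $\mathbb{F}_F$ of a finite frame $F=\{f_i\}_{i\in I}$ of nonzero vectors in $\mathcal{H}$ is the collection of subsets of $I$, ordered by inclusion, such that $\emptyset\in\mathbb{F}_F$ and a non-empty $J\subseteq I$ belongs to $\mathbb{F}_F$ if and only if $\{f_j\}_{j\in J}$ is a tight frame for (all of) $\mathcal{H}$. *)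

theory Defs
  imports "HOL-Analysis.Analysis"
begin

text \<open>
  A finite sequence of vectors is a family \<open>f\<close> restricted to a finite index set \<open>I\<close>; as
  \<open>f\<close> need not be injective, repeated vectors are allowed. Values of \<open>f\<close> outside \<open>I\<close>
  are irrelevant.
\<close>

definition frame_bounds :: "real \<Rightarrow> real \<Rightarrow> 'i set \<Rightarrow> ('i \<Rightarrow> 'a::euclidean_space) \<Rightarrow> bool" where
  "frame_bounds A B I f \<longleftrightarrow>
     0 < A \<and> 0 < B \<and>
     (\<forall>x. A * (norm x)\<^sup>2 \<le> (\<Sum>i\<in>I. \<bar>x \<bullet> f i\<bar>\<^sup>2) \<and> (\<Sum>i\<in>I. \<bar>x \<bullet> f i\<bar>\<^sup>2) \<le> B * (norm x)\<^sup>2)"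

definition is_frame :: "'i set \<Rightarrow> ('i \<Rightarrow> 'a::euclidean_space) \<Rightarrow> bool" where
  "is_frame I f \<longleftrightarrow> finite I \<and> (\<exists>A B. frame_bounds A B I f)"

definition is_tight_frame :: "'i set \<Rightarrow> ('i \<Rightarrow> 'a::euclidean_space) \<Rightarrow> bool" where
  "is_tight_frame I f \<longleftrightarrow> finite I \<and> (\<exists>A. frame_bounds A A I f)"

text \<open>
  The order on the factor poset is set inclusion, so the poset is determined by its
  underlying family of index sets.
\<close>

definition factor_poset :: "'i set \<Rightarrow> ('i \<Rightarrow> 'a::euclidean_space) \<Rightarrow> 'i set set" where
  "factor_poset I f = {J. J \<subseteq> I \<and> (J = {} \<or> is_tight_frame J f)}"

end

theory Submission
  imports Defs
begin

text \<open>
  Identify the plane with the complex numbers and send \<open>x\<close> to its square \<open>x\<^sup>2\<close>. Since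
  \<open>2 (x \<bullet> y)\<^sup>2 = \<bar>x\<bar>\<^sup>2 \<bar>y\<bar>\<^sup>2 + x\<^sup>2 \<bullet> y\<^sup>2\<close>, a family is a tight frame iff its squares sum to zero
  (and it is not identically zero). A generic \<open>u\<close> is orthogonal to none of the finitely many nonzero
  subfamily sums of squares, so the real numbers \<open>a\<^sub>i = u \<bullet> f\<^sub>i\<^sup>2\<close> have the same vanishing subfamily
  sums, and they are the squares of vectors on the two coordinate axes. As \<open>F\<close> spans the plane, two
  of the squares have different directions, and \<open>u\<close> may be chosen so that both signs
  occur among the \<open>a\<^sub>i\<close>; hence the new family spans the plane too.
\<close>

text \<open>In frame theory this is the diagram vector of \<open>x\<close>.\<close>

definition sq_vec :: "real ^ 2 \<Rightarrow> complex" where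
  "sq_vec x = (Complex (x $ 1) (x $ 2))\<^sup>2"

lemma sq_vec_eq: "sq_vec x = Complex ((x $ 1)\<^sup>2 - (x $ 2)\<^sup>2) (2 * x $ 1 * x $ 2)"
  by (simp add: sq_vec_def complex_eq_iff power2_eq_square)

lemma norm_real2: "(norm (x :: real ^ 2))\<^sup>2 = (x $ 1)\<^sup>2 + (x $ 2)\<^sup>2"
  unfolding power2_norm_eq_inner by (simp add: inner_vec_def sum_2 power2_eq_square)

lemma inner_real2: "(x :: real ^ 2) \<bullet> y = x $ 1 * y $ 1 + x $ 2 * y $ 2"
  by (simp add: inner_vec_def sum_2)

lemma norm_sq_vec: "norm (sq_vec x) = (norm x)\<^sup>2"
  by (simp add: sq_vec_def norm_power cmod_power2 norm_real2)

text \<open>Squaring doubles angles and squares norms, so this is the double-angle formula for the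
  cosine of the angle between \<open>x\<close> and \<open>y\<close>.\<close>

lemma inner_sq_vec: "2 * (x \<bullet> y)\<^sup>2 = (norm x)\<^sup>2 * (norm y)\<^sup>2 + sq_vec x \<bullet> sq_vec y"
  unfolding norm_real2 inner_real2 sq_vec_eq inner_complex_def
  by (simp add: power2_eq_square algebra_simps)

lemma frame_sum_eq:
  "2 * (\<Sum>j\<in>J. \<bar>x \<bullet> f j\<bar>\<^sup>2) =
     (norm x)\<^sup>2 * (\<Sum>j\<in>J. (norm (f j))\<^sup>2) + sq_vec x \<bullet> (\<Sum>j\<in>J. sq_vec (f j))"
  by (simp add: sum_distrib_left inner_sum_right inner_sq_vec sum.distrib)

lemma tight_frame_iff_sum_sq_vec:
  fixes f :: "'i \<Rightarrow> real ^ 2"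
  shows "is_tight_frame J f \<longleftrightarrow>
    finite J \<and> (\<exists>j\<in>J. f j \<noteq> 0) \<and> (\<Sum>j\<in>J. sq_vec (f j)) = 0"
    (is "_ \<longleftrightarrow> _ \<and> _ \<and> ?S = 0")
proof (cases "finite J")
  case True
  define N where "N = (\<Sum>j\<in>J. (norm (f j))\<^sup>2)"
  have eq: "2 * (\<Sum>j\<in>J. \<bar>x \<bullet> f j\<bar>\<^sup>2) = (norm x)\<^sup>2 * N + sq_vec x \<bullet> ?S" for x
    unfolding N_def by (rule frame_sum_eq)
  show ?thesis
  proof
    assume "is_tight_frame J f"
    then obtain A where "0 < A" and A: "\<And>x. (\<Sum>j\<in>J. \<bar>x \<bullet> f j\<bar>\<^sup>2) = A * (norm x)\<^sup>2"
      unfolding is_tight_frame_def frame_bounds_def by (meson order_antisym)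
    have bal: "2 * (A * (norm x)\<^sup>2) = (norm x)\<^sup>2 * N + sq_vec x \<bullet> ?S" for x
      using eq[of x] A[of x] by simp
    have "\<exists>j\<in>J. f j \<noteq> 0"
    proof (rule ccontr)
      assume "\<not> ?thesis"
      then show False
        using A[of "axis 1 1"] \<open>0 < A\<close> by simp
    qed
    \<comment> \<open>The first two test vectors have squares 1 and -1, which kills the real part
      and gives \<open>2 * A = N\<close>; the third has square 2i, which kills the imaginary
      part.\<close>
    moreover have "?S = 0"
      using bal[of "vector [1, 0]"] bal[of "vector [0, 1]"] bal[of "vector [1, 1]"]
      by (simp add: sq_vec_eq norm_real2 inner_complex_def complex_eq_iff)
    ultimately show "finite J \<and> (\<exists>j\<in>J. f j \<noteq> 0) \<and> ?S = 0"
      using True by blast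
  next
    assume R: "finite J \<and> (\<exists>j\<in>J. f j \<noteq> 0) \<and> ?S = 0"
    then obtain j where "j \<in> J" "f j \<noteq> 0" by blast
    then have "0 < N"
      unfolding N_def using True by (intro sum_pos2[of J j]) auto
    moreover have "(\<Sum>j\<in>J. \<bar>x \<bullet> f j\<bar>\<^sup>2) = N / 2 * (norm x)\<^sup>2" for x
      using eq[of x] R by (simp add: mult.commute)
    ultimately show "is_tight_frame J f"
      unfolding is_tight_frame_def frame_bounds_def using True
      by (intro conjI exI[of _ "N / 2"]) auto
  qed
qed (simp add: is_tight_frame_def)

text \<open>A hyperplane is closed with empty interior, so removing it from a non-empty open set
  leaves one; the induction removes one hyperplane at a time.\<close>

lemma open_avoids_finitely_many_hyperplanes:
  fixes V :: "'a::euclidean_space set"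
  assumes "finite V" "0 \<notin> V" "open U" "U \<noteq> {}"
  shows "\<exists>u\<in>U. \<forall>v\<in>V. v \<bullet> u \<noteq> 0"
  using assms
proof (induction V arbitrary: U rule: finite_induct)
  case empty
  then show ?case by auto
next
  case (insert v V)
  let ?U = "U - {x. v \<bullet> x = 0}"
  have "open ?U"
    using insert.prems closed_hyperplane by (intro open_Diff) auto
  moreover have "?U \<noteq> {}"
  proof
    assume "?U = {}"
    then have "U \<subseteq> interior {x. v \<bullet> x = 0}"
      using insert.prems by (intro interior_maximal) auto
    then show False
      using insert.prems interior_hyperplane[of v 0] by auto
  qed
  ultimately obtain u where "u \<in> ?U" "\<forall>w\<in>V. w \<bullet> u \<noteq> 0"
    using insert.IH[of ?U] insert.prems by auto
  then show ?case by auto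
qed

text \<open>Otherwise every vector of the family would be parallel to \<open>f i\<close>, and a
  vector perpendicular to \<open>f i\<close> would violate the lower frame bound.\<close>

lemma frame_sq_vec_directions:
  fixes f :: "'i \<Rightarrow> real ^ 2"
  assumes frame: "is_frame I f" and "i \<in> I" "f i \<noteq> 0"
  shows "\<exists>j\<in>I. sq_vec (f i) \<bullet> sq_vec (f j) < norm (sq_vec (f i)) * norm (sq_vec (f j))"
proof -
  \<comment> \<open>A quarter turn of \<open>f i\<close>: the norm is kept, and the square changes
    sign as its angle is doubled.\<close>
  define x :: "real ^ 2" where "x = vector [- f i $ 2, f i $ 1]"
  have nx: "(norm x)\<^sup>2 = (norm (f i))\<^sup>2"
    by (simp add: x_def norm_real2)
  have sx: "sq_vec x = - sq_vec (f i)"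
    by (simp add: x_def sq_vec_eq complex_eq_iff)
  obtain A where "0 < A" and A: "A * (norm x)\<^sup>2 \<le> (\<Sum>j\<in>I. \<bar>x \<bullet> f j\<bar>\<^sup>2)"
    using frame unfolding is_frame_def frame_bounds_def by blast
  have "0 < A * (norm x)\<^sup>2"
    using \<open>0 < A\<close> \<open>f i \<noteq> 0\<close> nx by simp
  with A have "(\<Sum>j\<in>I. \<bar>x \<bullet> f j\<bar>\<^sup>2) \<noteq> 0" by linarith
  then obtain j where "j \<in> I" "\<bar>x \<bullet> f j\<bar>\<^sup>2 \<noteq> 0"
    by (rule sum.not_neutral_contains_not_neutral)
  then have "0 < 2 * (x \<bullet> f j)\<^sup>2" by simp
  then have "sq_vec (f i) \<bullet> sq_vec (f j) < (norm (f i))\<^sup>2 * (norm (f j))\<^sup>2"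
    unfolding inner_sq_vec nx sx by simp
  then show ?thesis
    using \<open>j \<in> I\<close> by (auto simp: norm_sq_vec)
qed

lemma separating_direction:
  fixes v w :: "'a::real_inner"
  assumes "v \<noteq> 0" "w \<noteq> 0" "v \<bullet> w < norm v * norm w"
  shows "\<exists>u. 0 < v \<bullet> u \<and> w \<bullet> u < 0"
proof (intro exI conjI)
  \<comment> \<open>A positive multiple of the difference of the unit vectors along \<open>v\<close>
    and \<open>w\<close>.\<close>
  let ?u = "norm w *\<^sub>R v - norm v *\<^sub>R w"
  have "v \<bullet> ?u = norm v * (norm v * norm w - v \<bullet> w)"
    by (simp add: inner_diff_right dot_square_norm power2_eq_square algebra_simps)
  then show "0 < v \<bullet> ?u" using assms by simp
  have "w \<bullet> ?u = norm w * (v \<bullet> w - norm v * norm w)"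
    by (simp add: inner_diff_right dot_square_norm power2_eq_square inner_commute algebra_simps)
  then show "w \<bullet> ?u < 0"
    using assms by (simp add: mult_pos_neg)
qed

text \<open>A square root of \<open>a\<close> under \<open>sq_vec\<close>: the axes square to 1 and
  -1, so the sign of \<open>a\<close> selects the axis.\<close>

definition axis_vec :: "real \<Rightarrow> real ^ 2" where
  "axis_vec a = (if 0 < a then sqrt a *\<^sub>R axis 1 1 else sqrt (- a) *\<^sub>R axis 2 1)"

lemma sq_vec_axis_vec: "sq_vec (axis_vec a) = of_real a"
  by (simp add: axis_vec_def sq_vec_eq complex_eq_iff axis_def)

lemma axis_vec_eq_0_iff: "axis_vec a = 0 \<longleftrightarrow> a = 0"
  by (simp add: axis_vec_def axis_eq_0_iff)

text \<open>One vector on each axis already gives the lower bound; Cauchy-Schwarz gives the upper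
  one.\<close>

lemma is_frame_axis_vec:
  assumes "finite I" "i \<in> I" "0 < a i" "j \<in> I" "a j < 0"
  shows "is_frame I (\<lambda>l. axis_vec (a l))"
proof -
  let ?g = "\<lambda>l. axis_vec (a l)"
  define N where "N = (\<Sum>l\<in>I. (norm (?g l))\<^sup>2)"
  let ?A = "min (a i) (- a j)"
  have "i \<noteq> j" using assms by auto
  have "?A * (norm x)\<^sup>2 \<le> (\<Sum>l\<in>I. \<bar>x \<bullet> ?g l\<bar>\<^sup>2)" for x
  proof -
    have "?A * (norm x)\<^sup>2 \<le> a i * (x $ 1)\<^sup>2 + (- a j) * (x $ 2)\<^sup>2"
      unfolding norm_real2 distrib_left by (intro add_mono mult_right_mono) auto
    also have "\<dots> = (\<Sum>l\<in>{i, j}. \<bar>x \<bullet> ?g l\<bar>\<^sup>2)"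
      using assms \<open>i \<noteq> j\<close>
      by (simp add: axis_vec_def inner_axis power_mult_distrib)
    also have "\<dots> \<le> (\<Sum>l\<in>I. \<bar>x \<bullet> ?g l\<bar>\<^sup>2)"
      using assms by (intro sum_mono2) auto
    finally show ?thesis .
  qed
  moreover have "(\<Sum>l\<in>I. \<bar>x \<bullet> ?g l\<bar>\<^sup>2) \<le> N * (norm x)\<^sup>2" for x
    unfolding N_def sum_distrib_right
  proof (rule sum_mono)
    fix l
    have "\<bar>x \<bullet> ?g l\<bar>\<^sup>2 \<le> (norm x * norm (?g l))\<^sup>2"
      by (intro power_mono Cauchy_Schwarz_ineq2) simp
    then show "\<bar>x \<bullet> ?g l\<bar>\<^sup>2 \<le> (norm (?g l))\<^sup>2 * (norm x)\<^sup>2"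
      by (simp only: power_mult_distrib mult.commute)
  qed
  moreover have "0 < N"
    unfolding N_def using assms by (intro sum_pos2[of I i]) (auto simp: axis_vec_eq_0_iff)
  ultimately show ?thesis
    unfolding is_frame_def frame_bounds_def using assms
    by (intro conjI exI[of _ ?A] exI[of _ N]) auto
qed

theorem theorem3p1:
  fixes k :: nat and f :: "nat \<Rightarrow> real ^ 2"
  assumes "k \<ge> 1"
    and "\<And>i. i \<in> {1..k} \<Longrightarrow> f i \<noteq> 0"
    and "is_frame {1..k} f"
  shows "\<exists>g :: nat \<Rightarrow> real ^ 2.
           (\<forall>i\<in>{1..k}. g i \<noteq> 0) \<and>
           is_frame {1..k} g \<and>
           (\<forall>i\<in>{1..k}. \<exists>c::real. g i = c *\<^sub>R axis 1 1 \<or> g i = c *\<^sub>R axis 2 1) \<and>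
           factor_poset {1..k} f = factor_poset {1..k} g"
proof -
  define I where "I = {1..k}"
  define w where "w i = sq_vec (f i)" for i
  have "finite I" by (simp add: I_def)
  have f0: "f i \<noteq> 0" if "i \<in> I" for i
    using assms(2) that by (simp add: I_def)
  then have w0: "w i \<noteq> 0" if "i \<in> I" for i
    using that norm_sq_vec[of "f i"] by (auto simp: w_def)
  have i: "1 \<in> I" using assms(1) by (simp add: I_def)
  obtain j where j: "j \<in> I" and "w 1 \<bullet> w j < norm (w 1) * norm (w j)"
    using frame_sq_vec_directions[of I f 1] assms(3) f0[OF i] i by (auto simp: w_def I_def)
  then obtain u0 where u0: "0 < w 1 \<bullet> u0" "w j \<bullet> u0 < 0"
    using separating_direction w0 i by blast
  define V where "V = (\<lambda>J. \<Sum>i\<in>J. w i) ` Pow I - {0}"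
  \<comment> \<open>The sign conditions are open, so a generic \<open>u\<close> can be found among
    their solutions, of which \<open>u0\<close> is one.\<close>
  define U where "U = {u. 0 < w 1 \<bullet> u} \<inter> {u. w j \<bullet> u < 0}"
  have "open U"
    unfolding U_def by (intro open_Int open_halfspace_lt open_halfspace_gt)
  moreover have "finite V" "0 \<notin> V"
    using \<open>finite I\<close> by (auto simp: V_def)
  ultimately obtain u where u: "u \<in> U" "\<And>v. v \<in> V \<Longrightarrow> v \<bullet> u \<noteq> 0"
    using open_avoids_finitely_many_hyperplanes[of V U] u0 unfolding U_def by blast
  define a where "a i = w i \<bullet> u" for i
  \<comment> \<open>A non-zero sum of the \<open>w i\<close> lies in \<open>V\<close>, hence is not
    orthogonal to \<open>u\<close>; the converse is linearity.\<close>
  have sum_iff: "(\<Sum>i\<in>J. a i) = 0 \<longleftrightarrow> (\<Sum>i\<in>J. w i) = 0" if "J \<subseteq> I" for J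
    using u(2)[of "\<Sum>i\<in>J. w i"] that by (auto simp: a_def V_def simp flip: inner_sum_left)
  have a0: "a i \<noteq> 0" if "i \<in> I" for i
    using sum_iff[of "{i}"] w0 that by simp
  define g where "g i = axis_vec (a i)" for i
  have g0: "g i \<noteq> 0" if "i \<in> I" for i
    using a0 that by (simp add: g_def axis_vec_eq_0_iff)
  have "is_frame I g"
    unfolding g_def using \<open>finite I\<close> i j u(1)
    by (intro is_frame_axis_vec[of I 1 a j]) (auto simp: a_def U_def)
  moreover have "\<exists>c. g i = c *\<^sub>R axis 1 1 \<or> g i = c *\<^sub>R axis 2 1" for i
    by (auto simp: g_def axis_vec_def)
  moreover have "is_tight_frame J f \<longleftrightarrow> is_tight_frame J g" if "J \<subseteq> I" for J
  proof -
    have "(\<Sum>i\<in>J. sq_vec (g i)) = 0 \<longleftrightarrow> (\<Sum>i\<in>J. sq_vec (f i)) = 0"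
      using sum_iff[OF that] by (simp add: g_def sq_vec_axis_vec w_def flip: of_real_sum)
    \<comment> \<open>Neither family has a zero vector on \<open>I\<close>, so both sides just say
      that \<open>J\<close> is non-empty.\<close>
    moreover have "(\<exists>i\<in>J. f i \<noteq> 0) \<longleftrightarrow> (\<exists>i\<in>J. g i \<noteq> 0)"
      using f0 g0 that by blast
    ultimately show ?thesis
      by (simp add: tight_frame_iff_sum_sq_vec)
  qed
  then have "factor_poset I f = factor_poset I g"
    unfolding factor_poset_def by blast
  ultimately show ?thesis
    using g0 unfolding I_def by blast
qed

end
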